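(* Let $H>0$, $p,q\in(1,\infty)$ and $p^*=p/(p-1)$. Let $u$ be the positive solution $$u(x)=\frac{2H}{q\,\pi_{p^*,q}}\cos_{p^*,q}^{p^*-1}\!\left(\frac{\pi_{p^*,q}}{2H}x\right)\sin_{p^*,q}\!\left(\frac{\pi_{p^*,q}}{2H}x\right),\qquad 0\le x\le H,$$ of the boundary value problem $$(p-q)u'-pq(u')^2+(p+q)uu''+1=0\ \text{ on }(0,H),\qquad u(0)=u(H)=0.$$ Then $u$ has one and only one extremum in $(0,H)$, namely $$u(x_{p,q})=\frac{2H}{q\,\pi_{p^*,q}}\left(\frac{q}{p+q}\right)^{1/p}\left(\frac{p}{p+q}\right)^{1/q},$$ which is the maximum, attained at $$x_{p,q}=\frac{2H}{\pi_{p^*,q}}\sin_{p^*,q}^{-1}\!\left(\left(\frac{p}{p+q}\right)^{1/q}\right).$$ Moreover, $x_{p,q}<H/2$ if $p>q>1$; $x_{p,q}=H/2$ if $p=q>1$; and $x_{p,q}>H/2$ if $q>p>1$.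
   Context: For $s,q\in(1,\infty)$ define $\sin_{s,q}^{-1}x:=\int_0^x(1-t^q)^{-1/s}\,dt$ for $0\le x\le1$ and $\pi_{s,q}:=2\sin_{s,q}^{-1}1$. The function $\sin_{s,q}:[0,\pi_{s,q}/2]\to[0,1]$ is the (increasing) inverse function of $\sin_{s,q}^{-1}$, and $\cos_{s,q}x:=\frac{d}{dx}\sin_{s,q}x$, extended continuously to $[0,\pi_{s,q}/2]$; one has $\cos_{s,q}^s x+\sin_{s,q}^q x=1$ there. Powers are written $\cos_{s,q}^a x=(\cos_{s,q}x)^a$. It is known from earlier work (Kobayashi and Takeuchi) that the positive solution of the boundary value problem above is given by the displayed formula. *)

theory Defs
  imports "HOL-Analysis.Analysis"
begin

definition conj_exp :: "real \<Rightarrow> real" where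
  "conj_exp p = p / (p - 1)"

text \<open>Generalized trigonometric functions, for parameters \<open>s, q > 1\<close>. The integrand is unbounded
  at \<open>t = 1\<close>, where \<open>powr\<close> gives it the value 0; the Henstock--Kurzweil integral covers the
  improper integral at \<open>x = 1\<close>. The functions are meaningful only for \<open>x\<close> in \<open>[0, 1]\<close>,
  respectively in \<open>[0, gen_pi s q / 2]\<close>.\<close>

definition gen_arcsin :: "real \<Rightarrow> real \<Rightarrow> real \<Rightarrow> real" where
  "gen_arcsin s q x = integral {0..x} (\<lambda>t. (1 - t powr q) powr (- 1 / s))"

definition gen_pi :: "real \<Rightarrow> real \<Rightarrow> real" where
  "gen_pi s q = 2 * gen_arcsin s q 1"

definition gen_sin :: "real \<Rightarrow> real \<Rightarrow> real \<Rightarrow> real" where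
  "gen_sin s q = inv_into {0..1} (gen_arcsin s q)"

text \<open>The derivative of \<open>gen_sin\<close>, extended continuously to the end points, where the
  two-sided \<open>deriv\<close> would depend on the irrelevant values of \<open>gen_sin\<close> outside its domain.\<close>

definition gen_cos :: "real \<Rightarrow> real \<Rightarrow> real \<Rightarrow> real" where
  "gen_cos s q x =
     (if x \<in> {0<..<gen_pi s q / 2} then deriv (gen_sin s q) x
      else Lim (at x within {0<..<gen_pi s q / 2}) (deriv (gen_sin s q)))"

definition positive_solution :: "real \<Rightarrow> real \<Rightarrow> real \<Rightarrow> (real \<Rightarrow> real) \<Rightarrow> bool" where
  "positive_solution H p q u \<longleftrightarrow>
     continuous_on {0..H} u \<and>
     (\<forall>x\<in>{0<..<H}. u differentiable (at x) \<and> deriv u differentiable (at x)) \<and>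
     (\<forall>x\<in>{0<..<H}. (p - q) * deriv u x - p * q * (deriv u x)\<^sup>2
                      + (p + q) * u x * deriv (deriv u) x + 1 = 0) \<and>
     u 0 = 0 \<and> u H = 0 \<and>
     (\<forall>x\<in>{0<..<H}. u x > 0)"

definition local_extremum :: "(real \<Rightarrow> real) \<Rightarrow> real \<Rightarrow> bool" where
  "local_extremum u x \<longleftrightarrow>
     (\<forall>\<^sub>F y in nhds x. u y \<le> u x) \<or> (\<forall>\<^sub>F y in nhds x. u x \<le> u y)"

definition x_ext :: "real \<Rightarrow> real \<Rightarrow> real \<Rightarrow> real" where
  "x_ext H p q =
     2 * H / gen_pi (conj_exp p) q * gen_arcsin (conj_exp p) q ((p / (p + q)) powr (1 / q))"

end

theory Submission imports Defs begin

text \<open>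
  Write \<open>s = p / (p - 1)\<close>, \<open>P = gen_pi s q\<close> and \<open>t = gen_sin s q (P x / (2 H))\<close>. Inside the interval
  \<open>gen_cos s q\<close> is the derivative of the inverse of \<open>gen_arcsin s q\<close>, that is \<open>(1 - t powr q) powr (1 / s)\<close>,
  so \<open>u x\<close> is a positive constant times \<open>shape p q t = (1 - t powr q) powr (1 / p) * t\<close>. The map
  \<open>x \<mapsto> t\<close> is strictly increasing and \<open>shape\<close> strictly increases up to
  \<open>t0 = (p / (p + q)) powr (1 / q)\<close> and strictly decreases afterwards (\<open>shape_strict_mono\<close>,
  \<open>shape_strict_antimono\<close>). This gives the unique extremum, its position \<open>x_ext H p q\<close> and its
  value. The boundary values of \<open>u\<close> come from the boundary condition.

  The comparison of \<open>x_ext H p q\<close> with \<open>H / 2\<close> asks whether \<open>2 * gen_arcsin s q t0\<close> is smaller or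
  larger than \<open>gen_arcsin s q 1\<close>: whether \<open>u\<close> spends less time climbing or descending. The idea is to
  use the slope \<open>w = u' x = (1 - (p + q) / p * t powr q) / q\<close> as the independent variable. It
  decreases from \<open>1 / q\<close> at \<open>x = 0\<close> through \<open>0\<close> at the maximum to \<open>- 1 / p\<close> at \<open>x = H\<close>. The relative
  height of \<open>u\<close> becomes \<open>level p q w = (1 - q w) powr (1 / q) * (1 + p w) powr (1 / p)\<close>, and \<open>- dx\<close>
  becomes a positive constant times \<open>\<rho> w dw\<close> with \<open>\<rho> = slope_weight p q\<close>. Since
  \<open>dx = du / w\<close>, the derivative of \<open>level p q\<close> is \<open>- (p + q) * w * \<rho> w\<close>; as \<open>level p q\<close> vanishes at both
  ends, the climb and the descent have the same first moment \<open>\<integral> \<bar>w\<bar> \<rho> w dw\<close>, because they have the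
  same height.

  Suppose \<open>p > q\<close>. Then \<open>\<rho> w < \<rho> (- w)\<close> for \<open>0 < w < 1 / p\<close> (\<open>slope_weight_less_reflected\<close>),
  whereas beyond \<open>1 / p\<close> there is only climbing. Integrating \<open>1 / p - \<bar>w\<bar>\<close>, which is positive below the
  crossing point \<open>1 / p\<close> and negative above it, against \<open>\<rho>\<close> therefore gives a smaller value for the climb
  than for the descent. The first moments cancel, and the total weights, which are the two
  durations, are compared (\<open>slope_weight_halves_less\<close>). Exchanging \<open>p\<close> and \<open>q\<close> reflects \<open>w\<close>, which settles
  \<open>p < q\<close>; for \<open>p = q\<close> the weight is even.
\<close>

section \<open>Real powers\<close>

lemma powr_less_1:
  fixes x a :: real
  assumes "0 \<le> x" "x < 1" "a > 0"
  shows "x powr a < 1"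
  using assms powr_less_mono2[of a x 1] by simp

lemma DERIV_powr_compose:
  fixes f :: "real \<Rightarrow> real"
  assumes "(f has_real_derivative d) (at x)" "f x > 0"
  shows "((\<lambda>x. f x powr a) has_real_derivative a * f x powr (a - 1) * d) (at x)"
  by (rule DERIV_chain2[OF has_real_derivative_powr assms(1)]) (use assms in simp)

section \<open>The generalized arcsine and its inverse\<close>

text \<open>Since \<open>t powr q \<le> t\<close> on the unit interval, the singularity at \<open>1\<close> is no worse than that of
  \<open>(1 - t) powr (- 1 / s)\<close>, which has an explicit continuous primitive because \<open>s > 1\<close>.\<close>

lemma integrable_arcsin_integrand:
  fixes s q :: real
  assumes "s > 1" "q > 1"
  shows "(\<lambda>t. (1 - t powr q) powr (- 1 / s)) integrable_on {0..1}"
proof -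
  define r where "r = 1 - 1 / s"
  have r: "r > 0" and r1: "- 1 / s = r - 1" using assms by (auto simp: r_def field_simps)
  have "((\<lambda>t. (1 - t) powr (- 1 / s)) has_integral
           (- ((1 - 1) powr r) / r - - ((1 - 0) powr r) / r)) {0..1::real}"
  proof (rule fundamental_theorem_of_calculus_interior)
    show "continuous_on {0..1} (\<lambda>t. - ((1 - t) powr r) / r)"
      using r by (intro continuous_intros continuous_on_powr') auto
    fix t :: real assume "t \<in> {0<..<1}"
    then show "((\<lambda>t. - ((1 - t) powr r) / r) has_vector_derivative (1 - t) powr (- 1 / s)) (at t)"
      unfolding has_real_derivative_iff_has_vector_derivative[symmetric] r1
      using r DERIV_cdivide[OF DERIV_minus[OF DERIV_powr_compose[of "\<lambda>t. 1 - t" "- 1" t r]], of r]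
      by (auto intro!: derivative_eq_intros)
  qed simp
  then have int: "(\<lambda>t. (1 - t) powr (- 1 / s)) integrable_on {0..1::real}" by blast
  show ?thesis
  proof (rule measurable_bounded_by_integrable_imp_integrable[OF _ int])
    show "(\<lambda>t. (1 - t powr q) powr (- 1 / s)) \<in> borel_measurable (lebesgue_on {0..1})"
      by (intro borel_measurable_if_D measurable_completion) measurable
    fix t :: real assume t: "t \<in> {0..1}"
    show "norm ((1 - t powr q) powr (- 1 / s)) \<le> (1 - t) powr (- 1 / s)"
    proof (cases "t = 1")
      case False
      have "t powr q \<le> t powr 1" using t assms by (intro powr_mono') auto
      then have "1 - t \<le> 1 - t powr q" using t by simp
      then have "(1 - t powr q) powr (- 1 / s) \<le> (1 - t) powr (- 1 / s)"
        using t False assms by (intro powr_mono2') auto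
      then show ?thesis by simp
    qed simp
  qed simp
qed

lemma continuous_on_gen_arcsin:
  assumes "s > 1" "q > 1"
  shows "continuous_on {0..1} (gen_arcsin s q)"
  unfolding gen_arcsin_def
  by (rule indefinite_integral_continuous_1[OF integrable_arcsin_integrand[OF assms]])

lemma DERIV_gen_arcsin:
  assumes "s > 1" "q > 1" "0 < x" "x < 1"
  shows "(gen_arcsin s q has_real_derivative (1 - x powr q) powr (- 1 / s)) (at x)"
proof -
  \<comment> \<open>Cutting off at \<open>b\<close> strictly between \<open>x\<close> and \<open>1\<close> keeps the integrand continuous.\<close>
  define b where "b = (x + 1) / 2"
  have b: "x < b" "b < 1" using assms by (auto simp: b_def)
  have "t powr q < 1" if "t \<in> {0..b}" for t
    using that b assms by (intro powr_less_1) auto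
  then have "continuous_on {0..b} (\<lambda>t. (1 - t powr q) powr (- 1 / s))"
    using assms by (intro continuous_on_powr' continuous_intros) force+
  then have "((\<lambda>y. integral {0..y} (\<lambda>t. (1 - t powr q) powr (- 1 / s)))
      has_real_derivative (1 - x powr q) powr (- 1 / s)) (at x within {0..b})"
    using assms b by (intro integral_has_real_derivative) auto
  then show ?thesis using assms b
    by (simp add: gen_arcsin_def[abs_def] at_within_interior[of x "{0..b}"])
qed

lemma gen_arcsin_0: "gen_arcsin s q 0 = 0"
  by (simp add: gen_arcsin_def)

lemma gen_arcsin_strict_mono:
  assumes "s > 1" "q > 1" "0 \<le> x" "x < y" "y \<le> 1"
  shows "gen_arcsin s q x < gen_arcsin s q y"
proof (rule DERIV_pos_imp_increasing_open[OF assms(4)])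
  fix t assume t: "x < t" "t < y"
  then have "t powr q < 1" using assms by (intro powr_less_1) auto
  then show "\<exists>D. (gen_arcsin s q has_real_derivative D) (at t) \<and> 0 < D"
    using assms t by (intro exI[of _ "(1 - t powr q) powr (- 1 / s)"] conjI DERIV_gen_arcsin) auto
next
  show "continuous_on {x..y} (gen_arcsin s q)"
    by (rule continuous_on_subset[OF continuous_on_gen_arcsin[OF assms(1,2)]]) (use assms in auto)
qed

lemma gen_pi_pos: "s > 1 \<Longrightarrow> q > 1 \<Longrightarrow> gen_pi s q > 0"
  using gen_arcsin_strict_mono[of s q 0 1] by (simp add: gen_pi_def gen_arcsin_0)

lemma inj_on_gen_arcsin:
  assumes "s > 1" "q > 1" shows "inj_on (gen_arcsin s q) {0..1}"
  using gen_arcsin_strict_mono[OF assms] by (intro linorder_inj_onI') force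

lemma gen_sin_gen_arcsin:
  assumes "s > 1" "q > 1" "0 \<le> t" "t \<le> 1"
  shows "gen_sin s q (gen_arcsin s q t) = t"
  unfolding gen_sin_def using assms by (intro inv_into_f_f inj_on_gen_arcsin) auto

lemma gen_arcsin_image:
  assumes "s > 1" "q > 1"
  shows "gen_arcsin s q ` {0..1} = {0..gen_pi s q / 2}"
proof (intro equalityI subsetI)
  fix y assume "y \<in> {0..gen_pi s q / 2}"
  then show "y \<in> gen_arcsin s q ` {0..1}"
    using IVT'[of "gen_arcsin s q" 0 y 1] continuous_on_gen_arcsin[OF assms]
    by (force simp: gen_pi_def gen_arcsin_0)
next
  fix y assume "y \<in> gen_arcsin s q ` {0..1}"
  then obtain t where t: "y = gen_arcsin s q t" "0 \<le> t" "t \<le> 1" by auto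
  then show "y \<in> {0..gen_pi s q / 2}"
    using gen_arcsin_strict_mono[OF assms, of 0 t] gen_arcsin_strict_mono[OF assms, of t 1]
    by (cases "t = 0"; cases "t = 1") (auto simp: gen_pi_def gen_arcsin_0)
qed

lemma gen_sin_inverse:
  assumes "s > 1" "q > 1" "0 \<le> y" "y \<le> gen_pi s q / 2"
  shows "0 \<le> gen_sin s q y" "gen_sin s q y \<le> 1" "gen_arcsin s q (gen_sin s q y) = y"
proof -
  have y: "y \<in> gen_arcsin s q ` {0..1}" using assms gen_arcsin_image by simp
  show "gen_arcsin s q (gen_sin s q y) = y" "0 \<le> gen_sin s q y" "gen_sin s q y \<le> 1"
    using inv_into_into[OF y] f_inv_into_f[OF y] by (auto simp: gen_sin_def)
qed

lemma gen_sin_strict_mono: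
  assumes "s > 1" "q > 1" "0 \<le> x" "x < y" "y \<le> gen_pi s q / 2"
  shows "gen_sin s q x < gen_sin s q y"
proof (rule ccontr)
  assume "\<not> ?thesis"
  then have "gen_arcsin s q (gen_sin s q y) \<le> gen_arcsin s q (gen_sin s q x)"
    using gen_arcsin_strict_mono[of s q "gen_sin s q y" "gen_sin s q x"]
      gen_sin_inverse[of s q x] gen_sin_inverse[of s q y] assms
    by (cases "gen_sin s q y = gen_sin s q x") auto
  then show False using gen_sin_inverse(3)[of s q x] gen_sin_inverse(3)[of s q y] assms by simp
qed

lemma gen_sin_0: "s > 1 \<Longrightarrow> q > 1 \<Longrightarrow> gen_sin s q 0 = 0"
  using gen_sin_gen_arcsin[of s q 0] by (simp add: gen_arcsin_0)

lemma gen_sin_pi_half: "s > 1 \<Longrightarrow> q > 1 \<Longrightarrow> gen_sin s q (gen_pi s q / 2) = 1"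
  using gen_sin_gen_arcsin[of s q 1] by (simp add: gen_pi_def)

lemma gen_sin_interior:
  assumes "s > 1" "q > 1" "0 < y" "y < gen_pi s q / 2"
  shows "0 < gen_sin s q y" "gen_sin s q y < 1"
  using gen_sin_strict_mono[of s q 0 y] gen_sin_strict_mono[of s q y "gen_pi s q / 2"] assms
  by (auto simp: gen_sin_0 gen_sin_pi_half)

text \<open>In the interior \<open>gen_cos\<close> is a genuine derivative, so the rule for inverse functions turns it into
  the reciprocal of the arcsine integrand; this is the identity
  \<open>gen_cos s q y powr s + gen_sin s q y powr q = 1\<close> solved for \<open>gen_cos\<close>.\<close>

lemma gen_cos_eq:
  assumes "s > 1" "q > 1" "0 < y" "y < gen_pi s q / 2"
  shows "gen_cos s q y = (1 - gen_sin s q y powr q) powr (1 / s)"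
proof -
  let ?S = "gen_sin s q" and ?F = "gen_arcsin s q"
  have Sy: "0 < ?S y" "?S y < 1" using gen_sin_interior[OF assms] .
  then have pos: "?S y powr q < 1" using powr_less_1[of "?S y" q] assms by auto
  have "continuous_on {0..gen_pi s q / 2} ?S"
    using continuous_on_inv[OF continuous_on_gen_arcsin[OF assms(1,2)], of ?S]
      gen_sin_gen_arcsin[OF assms(1,2)] gen_arcsin_image[OF assms(1,2)] by auto
  then have cont: "isCont ?S y"
    using assms by (intro continuous_on_interior) auto
  have "(?S has_real_derivative inverse ((1 - ?S y powr q) powr (- 1 / s))) (at y)"
  proof (rule DERIV_inverse_function[where f = ?F and a = 0 and b = "gen_pi s q / 2"])
    show "(?F has_real_derivative (1 - ?S y powr q) powr (- 1 / s)) (at (?S y))"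
      using DERIV_gen_arcsin assms Sy by blast
    show "(1 - ?S y powr q) powr (- 1 / s) \<noteq> 0" using pos by simp
  qed (use assms cont gen_sin_inverse(3) in auto)
  then have "deriv ?S y = (1 - ?S y powr q) powr (1 / s)"
    by (simp add: DERIV_imp_deriv powr_minus)
  then show ?thesis using assms by (simp add: gen_cos_def)
qed

section \<open>The profile of the solution\<close>

definition shape :: "real \<Rightarrow> real \<Rightarrow> real \<Rightarrow> real" where
  "shape p q t = (1 - t powr q) powr (1 / p) * t"

lemma continuous_on_shape:
  assumes "p > 0" "q > 0"
  shows "continuous_on {0..1} (shape p q)"
proof -
  have "1 - t powr q \<ge> 0" if "t \<in> {0..1}" for t :: real
    using that assms powr_le1[of q t] by auto
  then show ?thesis unfolding shape_def using assms
    by (intro continuous_intros continuous_on_powr') auto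
qed

text \<open>The derivative is factored so that its sign is that of \<open>p - (p + q) * t powr q\<close>.\<close>

lemma DERIV_shape:
  assumes "p > 0" "q > 0" "0 < t" "t < 1"
  shows "(shape p q has_real_derivative
            (1 - t powr q) powr (1 / p - 1) * ((p - (p + q) * t powr q) / p)) (at t)"
proof -
  have pos: "t powr q < 1" using assms by (intro powr_less_1) auto
  define y where "y = 1 - t powr q"
  have y: "y > 0" "t powr q = 1 - y" using pos by (simp_all add: y_def)
  have "((\<lambda>t. 1 - t powr q) has_real_derivative - (q * t powr (q - 1))) (at t)"
    using assms by (auto intro!: derivative_eq_intros has_real_derivative_powr)
  from DERIV_mult[OF DERIV_powr_compose[OF this, of "1 / p"] DERIV_ident] pos
  have der: "(shape p q has_real_derivative
      1 / p * y powr (1 / p - 1) * - (q * t powr (q - 1)) * t + y powr (1 / p)) (at t)"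
    by (simp add: shape_def[abs_def] y_def algebra_simps)
  have ty: "t powr (q - 1) * t = 1 - y" and "y powr (1 / p) = y powr (1 / p - 1) * y"
    using assms y by (simp_all add: powr_diff)
  then have "1 / p * y powr (1 / p - 1) * - (q * t powr (q - 1)) * t + y powr (1 / p)
      = y powr (1 / p - 1) * (y - q / p * (t powr (q - 1) * t))"
    by (simp add: algebra_simps)
  also have "y - q / p * (t powr (q - 1) * t) = (p - (p + q) * t powr q) / p"
    unfolding ty y(2) using assms by (simp add: field_simps)
  finally show ?thesis using der by (simp add: y_def)
qed

lemma shape_strict_mono:
  assumes "p > 0" "q > 0" "0 \<le> t" "t < t'" "t' \<le> (p / (p + q)) powr (1 / q)"
  shows "shape p q t < shape p q t'"
proof (rule DERIV_pos_imp_increasing_open[OF assms(4)])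
  have 1: "(p / (p + q)) powr (1 / q) \<le> 1" using assms by (intro powr_le1) auto
  show "continuous_on {t..t'} (shape p q)"
    by (rule continuous_on_subset[OF continuous_on_shape[OF assms(1,2)]]) (use assms 1 in auto)
  fix x assume x: "t < x" "x < t'"
  have "x powr q < ((p / (p + q)) powr (1 / q)) powr q"
    using assms x by (intro powr_less_mono2) auto
  then have "x powr q < p / (p + q)" using assms by (simp add: powr_powr)
  then have "0 < (p - (p + q) * x powr q) / p" using assms by (simp add: field_simps)
  moreover have "x powr q < 1" using assms x 1 by (intro powr_less_1) auto
  ultimately show "\<exists>D. (shape p q has_real_derivative D) (at x) \<and> 0 < D"
    using assms x 1 by (intro exI[of _ "(1 - x powr q) powr (1 / p - 1) * ((p - (p + q) * x powr q) / p)"]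
        conjI DERIV_shape mult_pos_pos) auto
qed

lemma shape_strict_antimono:
  assumes "p > 0" "q > 0" "(p / (p + q)) powr (1 / q) \<le> t" "t < t'" "t' \<le> 1"
  shows "shape p q t > shape p q t'"
proof (rule DERIV_neg_imp_decreasing_open[OF assms(4)])
  have "(p / (p + q)) powr (1 / q) > 0" using assms by simp
  then have 0: "t > 0" using assms by linarith
  show "continuous_on {t..t'} (shape p q)"
    by (rule continuous_on_subset[OF continuous_on_shape[OF assms(1,2)]]) (use assms 0 in auto)
  fix x assume x: "t < x" "x < t'"
  have "x powr q > ((p / (p + q)) powr (1 / q)) powr q"
    using assms x 0 by (intro powr_less_mono2) auto
  then have "x powr q > p / (p + q)" using assms by (simp add: powr_powr)
  then have "(p - (p + q) * x powr q) / p < 0" using assms by (simp add: field_simps)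
  moreover have "x powr q < 1" using assms x 0 by (intro powr_less_1) auto
  ultimately show "\<exists>D. (shape p q has_real_derivative D) (at x) \<and> D < 0"
    using assms x 0 by (intro exI[of _ "(1 - x powr q) powr (1 / p - 1) * ((p - (p + q) * x powr q) / p)"]
        conjI DERIV_shape mult_pos_neg) auto
qed

section \<open>Local extrema\<close>

lemma not_local_extremum_if_strict_mono:
  assumes "a < x" "x < b" "strict_mono_on {a<..<b} u"
  shows "\<not> local_extremum u x"
proof -
  have R: "\<forall>\<^sub>F y in at_right x. y \<in> {x<..<b}"
    and L: "\<forall>\<^sub>F y in at_left x. y \<in> {a<..<x}"
    using eventually_at_right_real[OF assms(2)] eventually_at_left_real[OF assms(1)] by auto
  have R': "\<forall>\<^sub>F y in at_right x. u x < u y"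
    using R by eventually_elim (use assms strict_mono_onD[OF assms(3), of x] in simp)
  have L': "\<forall>\<^sub>F y in at_left x. u y < u x"
    using L by eventually_elim (use assms strict_mono_onD[OF assms(3), of _ x] in simp)
  have le: "at_right x \<le> nhds x" "at_left x \<le> nhds x" by (auto simp: at_within_def)
  have "\<not> (\<forall>\<^sub>F y in nhds x. u y \<le> u x)"
  proof
    assume "\<forall>\<^sub>F y in nhds x. u y \<le> u x"
    from filter_leD[OF le(1) this] R' have "\<forall>\<^sub>F y in at_right x. False" by eventually_elim auto
    then show False by simp
  qed
  moreover have "\<not> (\<forall>\<^sub>F y in nhds x. u x \<le> u y)"
  proof
    assume "\<forall>\<^sub>F y in nhds x. u x \<le> u y"
    from filter_leD[OF le(2) this] L' have "\<forall>\<^sub>F y in at_left x. False" by eventually_elim auto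
    then show False by simp
  qed
  ultimately show ?thesis by (simp add: local_extremum_def)
qed

lemma local_extremum_uminus: "local_extremum (\<lambda>x. - u x) x \<longleftrightarrow> local_extremum u x"
  by (auto simp: local_extremum_def)

section \<open>The slope as independent variable\<close>

text \<open>Up to a constant, this is the density of \<open>x\<close> with respect to the slope \<open>w\<close> of the solution; it is an
  unnormalised Beta density whose interval \<open>(- 1 / p, 1 / q)\<close> is placed so that the maximum of the solution sits
  at \<open>w = 0\<close>.\<close>

definition slope_weight :: "real \<Rightarrow> real \<Rightarrow> real \<Rightarrow> real" where
  "slope_weight p q w = (1 - q * w) powr (1 / q - 1) * (1 + p * w) powr (1 / p - 1)"

lemma slope_weight_pos: "- 1 / p < w \<Longrightarrow> w < 1 / q \<Longrightarrow> p > 0 \<Longrightarrow> q > 0 \<Longrightarrow> slope_weight p q w > 0"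
  by (simp add: slope_weight_def field_simps)

lemma slope_weight_swap: "slope_weight q p (- w) = slope_weight p q w"
  by (simp add: slope_weight_def mult.commute)

text \<open>The logarithm of \<open>slope_weight p q w / slope_weight p q (- w)\<close> vanishes at \<open>0\<close>, and its derivative is
  \<open>2 (q - 1) / (1 - (q w)^2) - 2 (p - 1) / (1 - (p w)^2)\<close>, which is negative because \<open>p > q\<close>
  makes the second numerator larger and the second denominator smaller.\<close>

lemma slope_weight_less_reflected:
  fixes p q w :: real
  assumes "p > q" "q > 1" "0 < w" "w < 1 / p"
  shows "slope_weight p q w < slope_weight p q (- w)"
proof -
  \<comment> \<open>The logarithm of the ratio of the two weights.\<close>
  define f where "f x = (1 / q - 1) * (ln (1 - q * x) - ln (1 + q * x))
                       + (1 / p - 1) * (ln (1 + p * x) - ln (1 - p * x))" for x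
  have bnd: "q * x < 1 \<and> p * x < 1" if "0 \<le> x" "x \<le> w" for x
  proof -
    have "p * x \<le> p * w" "p * w < 1" using that assms by (auto simp: field_simps)
    moreover have "q * x \<le> p * x" using that assms by (intro mult_right_mono) auto
    ultimately show ?thesis by linarith
  qed
  have "f w < f 0"
  proof (rule DERIV_neg_imp_decreasing_open[OF assms(3)])
    have nz: "1 - q * x > 0" "1 + q * x > 0" "1 + p * x > 0" "1 - p * x > 0" if "x \<in> {0..w}" for x
      using bnd[of x] that assms by (auto intro!: add_pos_nonneg)
    show "continuous_on {0..w} f" unfolding f_def
      by (intro continuous_intros ballI) (metis nz less_irrefl)+
    fix x assume x: "0 < x" "x < w"
    define D where "D = 2 * (q - 1) / (1 - (q * x)\<^sup>2) - 2 * (p - 1) / (1 - (p * x)\<^sup>2)"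
    have b: "q * x < 1" "p * x < 1" "0 < q * x" "q * x < p * x" using bnd x assms by auto
    have "(f has_real_derivative D) (at x)"
    proof -
      have nz: "1 - q * x > 0" "1 + q * x > 0" "1 + p * x > 0" "1 - p * x > 0" using b by auto
      have e: "1 - (q * x)\<^sup>2 = (1 - q * x) * (1 + q * x)" "1 - (p * x)\<^sup>2 = (1 - p * x) * (1 + p * x)"
        by (auto simp: power2_eq_square algebra_simps)
      have d: "((\<lambda>x. ln (1 - q * x)) has_real_derivative - q / (1 - q * x)) (at x)"
        "((\<lambda>x. ln (1 + q * x)) has_real_derivative q / (1 + q * x)) (at x)"
        "((\<lambda>x. ln (1 + p * x)) has_real_derivative p / (1 + p * x)) (at x)"
        "((\<lambda>x. ln (1 - p * x)) has_real_derivative - p / (1 - p * x)) (at x)"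
        using nz by (auto intro!: derivative_eq_intros)
      have "(f has_real_derivative (1 / q - 1) * (- q / (1 - q * x) - q / (1 + q * x))
          + (1 / p - 1) * (p / (1 + p * x) - - p / (1 - p * x))) (at x)"
        unfolding f_def[abs_def] by (intro DERIV_add DERIV_cmult DERIV_diff d)
      moreover have "(1 / q - 1) * (- q / (1 - q * x) - q / (1 + q * x)) = 2 * (q - 1) / (1 - (q * x)\<^sup>2)"
        unfolding e using nz assms by (simp add: divide_simps) (simp add: algebra_simps)
      moreover have "(1 / p - 1) * (p / (1 + p * x) - - p / (1 - p * x)) = - (2 * (p - 1) / (1 - (p * x)\<^sup>2))"
        unfolding e using nz assms by (simp add: divide_simps) (simp add: algebra_simps)
      ultimately show ?thesis unfolding D_def by simp
    qed
    moreover have "D < 0"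
    proof -
      have "(q * x)\<^sup>2 < (p * x)\<^sup>2" "(p * x)\<^sup>2 < 1"
        using b power_strict_mono[of "q * x" "p * x" 2] power_strict_mono[of "p * x" 1 2] by auto
      then have "2 * (q - 1) / (1 - (q * x)\<^sup>2) < 2 * (p - 1) / (1 - (p * x)\<^sup>2)"
        using assms by (intro frac_less[where x = "2 * (q - 1)"]) auto
      then show ?thesis by (simp add: D_def)
    qed
    ultimately show "\<exists>D. (f has_real_derivative D) (at x) \<and> D < 0" by blast
  qed
  then have "f w < 0" by (simp add: f_def)
  have b: "q * w < 1" "p * w < 1" "0 < q * w" "0 < p * w" using bnd[of w] assms by auto
  have "slope_weight p q w = exp ((1 / q - 1) * ln (1 - q * w) + (1 / p - 1) * ln (1 + p * w))"
    "slope_weight p q (- w) = exp ((1 / q - 1) * ln (1 + q * w) + (1 / p - 1) * ln (1 - p * w))"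
    using b by (auto simp: slope_weight_def powr_def exp_add)
  then show ?thesis using \<open>f w < 0\<close> by (simp add: f_def algebra_simps)
qed

text \<open>The height of the solution relative to its maximum, as a function of the slope.\<close>

definition level :: "real \<Rightarrow> real \<Rightarrow> real \<Rightarrow> real" where
  "level p q w = (1 - q * w) powr (1 / q) * (1 + p * w) powr (1 / p)"

lemma continuous_on_level:
  assumes "p > 0" "q > 0"
  shows "continuous_on {- 1 / p..1 / q} (level p q)"
  unfolding level_def using assms
  by (intro continuous_intros continuous_on_powr') (auto simp: field_simps)

text \<open>So \<open>level\<close> serves as a primitive for the first moment of \<open>slope_weight\<close>.\<close>

lemma DERIV_level:
  assumes "p > 0" "q > 0" "- 1 / p < w" "w < 1 / q"
  shows "(level p q has_real_derivative - (p + q) * w * slope_weight p q w) (at w)"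
proof -
  have "1 - q * w > 0" "1 + p * w > 0" using assms by (auto simp: field_simps)
  then have pos: "1 - q * w > 0" "1 + p * w > 0" .
  have "((\<lambda>w. 1 - q * w) has_real_derivative - q) (at w)" "((\<lambda>w. 1 + p * w) has_real_derivative p) (at w)"
    by (auto intro!: derivative_eq_intros)
  from DERIV_mult[OF DERIV_powr_compose[OF this(1) pos(1), of "1 / q"]
      DERIV_powr_compose[OF this(2) pos(2), of "1 / p"]]
  have "(level p q has_real_derivative
      1 / q * (1 - q * w) powr (1 / q - 1) * - q * (1 + p * w) powr (1 / p) +
      1 / p * (1 + p * w) powr (1 / p - 1) * p * (1 - q * w) powr (1 / q)) (at w)"
    by (simp add: level_def[abs_def])
  moreover have e: "(1 - q * w) powr (1 / q) = (1 - q * w) powr (1 / q - 1) * (1 - q * w)"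
    "(1 + p * w) powr (1 / p) = (1 + p * w) powr (1 / p - 1) * (1 + p * w)"
    using pos by (simp_all add: powr_diff)
  have "1 / q * (1 - q * w) powr (1 / q - 1) * - q * (1 + p * w) powr (1 / p) +
      1 / p * (1 + p * w) powr (1 / p - 1) * p * (1 - q * w) powr (1 / q)
      = - (p + q) * w * slope_weight p q w"
    unfolding e slope_weight_def using assms by (simp add: algebra_simps)
  ultimately show ?thesis by simp
qed

text \<open>Both halves of the weight have the same first moment, since \<open>level\<close> vanishes at both ends. Hence it
  suffices to compare them after multiplication by \<open>1 / p - \<bar>w\<bar>\<close>. The factor has the sign that
  exploits the pointwise comparison: below \<open>1 / p\<close> it is positive and the left half is heavier, above
  \<open>1 / p\<close> it is negative and only the right half has mass. Primitives replace the integrals.\<close>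

lemma slope_weight_halves_less:
  fixes K :: "real \<Rightarrow> real" and p q c :: real
  assumes pq: "p > q" "q > 1" and c: "c > 0"
    and cont: "continuous_on {- 1 / p..1 / q} K"
    and der: "\<And>w. - 1 / p < w \<Longrightarrow> w < 1 / q \<Longrightarrow>
                (K has_real_derivative c * slope_weight p q w) (at w)"
  shows "K (1 / q) - K 0 < K 0 - K (- 1 / p)"
proof -
  \<comment> \<open>Primitives of \<open>1 / p - w\<close> times the weight, on the right half and on the reflected left half.\<close>
  define J where "J w = K w / p + c * level p q w / (p + q)" for w
  define J' where "J' w = - K (- w) / p + c * level p q (- w) / (p + q)" for w
  have lt: "1 / p < 1 / q" using pq by (simp add: frac_less2)
  have "1 / p > 0" using pq by simp
  have contJ: "continuous_on {- 1 / p..1 / q} J" unfolding J_def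
    by (intro continuous_intros cont continuous_on_level) (use pq in auto)
  have contJ': "continuous_on {0..1 / p} J'" unfolding J'_def
    by (intro continuous_intros continuous_on_compose2[OF cont]
        continuous_on_compose2[OF continuous_on_level[of p q]]) (use pq lt in auto)
  have derJ: "(J has_real_derivative c * slope_weight p q w * (1 / p - w)) (at w)"
    if "- 1 / p < w" "w < 1 / q" for w
  proof -
    have L: "(level p q has_real_derivative - (p + q) * w * slope_weight p q w) (at w)"
      by (rule DERIV_level) (use pq that in auto)
    have "(J has_real_derivative c * slope_weight p q w / p
            + c * (- (p + q) * w * slope_weight p q w) / (p + q)) (at w)"
      unfolding J_def[abs_def] by (intro DERIV_add DERIV_cdivide DERIV_cmult der[OF that] L)
    moreover have "c * slope_weight p q w / p + c * (- (p + q) * w * slope_weight p q w) / (p + q)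
        = c * slope_weight p q w * (1 / p - w)"
      using pq by (simp add: divide_simps) (simp add: algebra_simps)
    ultimately show ?thesis by simp
  qed
  have derJ': "(J' has_real_derivative c * slope_weight p q (- w) * (1 / p - w)) (at w)"
    if "0 < w" "w < 1 / p" for w
  proof -
    have b: "- 1 / p < - w" "- w < 1 / q" using that lt pq by auto
    have m: "(uminus has_real_derivative - 1) (at w)" by (auto intro!: derivative_eq_intros)
    have dK: "((\<lambda>w. K (- w)) has_real_derivative c * slope_weight p q (- w) * - 1) (at w)"
      by (rule DERIV_chain2[OF der[OF b] m])
    have dL: "((\<lambda>w. level p q (- w)) has_real_derivative
        - (p + q) * (- w) * slope_weight p q (- w) * - 1) (at w)"
      by (rule DERIV_chain2[OF DERIV_level[OF _ _ b] m]) (use pq in auto)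
    have "(J' has_real_derivative - (c * slope_weight p q (- w) * - 1) / p
            + c * (- (p + q) * (- w) * slope_weight p q (- w) * - 1) / (p + q)) (at w)"
      unfolding J'_def[abs_def] by (intro DERIV_add DERIV_minus DERIV_cdivide DERIV_cmult dK dL)
    moreover have "- (c * slope_weight p q (- w) * - 1) / p
        + c * (- (p + q) * (- w) * slope_weight p q (- w) * - 1) / (p + q)
        = c * slope_weight p q (- w) * (1 / p - w)"
      using pq by (simp add: divide_simps) (simp add: algebra_simps)
    ultimately show ?thesis by simp
  qed
  have "J (1 / q) < J (1 / p)"
  proof (rule DERIV_neg_imp_decreasing_open[OF lt])
    show "continuous_on {1 / p..1 / q} J"
      by (rule continuous_on_subset[OF contJ]) (use pq \<open>1/p>0\<close> in auto)
    fix w assume w: "1 / p < w" "w < 1 / q"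
    have "- 1 / p < 0" using pq by simp
    then have "w > - 1 / p" using w(1) \<open>1/p>0\<close> by linarith
    then show "\<exists>D. (J has_real_derivative D) (at w) \<and> D < 0"
      using w pq c by (intro exI[of _ "c * slope_weight p q w * (1 / p - w)"] conjI derJ
          mult_pos_neg mult_pos_pos slope_weight_pos) auto
  qed
  moreover have "J' 0 - J 0 < J' (1 / p) - J (1 / p)"
  proof (rule DERIV_pos_imp_increasing_open[OF \<open>1/p>0\<close>])
    show "continuous_on {0..1 / p} (\<lambda>w. J' w - J w)"
      by (intro continuous_intros contJ' continuous_on_subset[OF contJ]) (use \<open>1/p>0\<close> lt in auto)
    fix w assume w: "0 < w" "w < 1 / p"
    have "c * slope_weight p q w * (1 / p - w) < c * slope_weight p q (- w) * (1 / p - w)"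
      using slope_weight_less_reflected[of q p w] w pq c by (intro mult_strict_right_mono) auto
    moreover have "((\<lambda>w. J' w - J w) has_real_derivative
        c * slope_weight p q (- w) * (1 / p - w) - c * slope_weight p q w * (1 / p - w)) (at w)"
      using w lt \<open>1/p>0\<close> by (intro DERIV_diff derJ derJ') auto
    ultimately show "\<exists>D. ((\<lambda>w. J' w - J w) has_real_derivative D) (at w) \<and> 0 < D"
      by (intro exI conjI) (assumption, linarith)
  qed
  ultimately have "J (1 / q) - J 0 < J' (1 / p) - J' 0" by linarith
  \<comment> \<open>The first moments on the two sides are both \<open>c * level p q 0 / (p + q)\<close> and cancel.\<close>
  moreover have "level p q (1 / q) = 0" "level p q (- (1 / p)) = 0" using pq by (auto simp: level_def)
  ultimately have "K (1 / q) / p - K 0 / p < - K (- 1 / p) / p + K 0 / p"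
    by (simp add: J_def J'_def)
  then have "(K (1 / q) - K 0) / p < (K 0 - K (- 1 / p)) / p"
    by (simp add: diff_divide_distrib)
  then show ?thesis using pq by (simp add: divide_less_cancel)
qed

text \<open>Exchanging \<open>p\<close> and \<open>q\<close> amounts to \<open>w \<mapsto> - w\<close>, under which a primitive \<open>K w\<close> becomes \<open>- K (- w)\<close>.\<close>

lemma slope_weight_halves_compare:
  fixes K :: "real \<Rightarrow> real" and p q c :: real
  assumes pq: "p > 1" "q > 1" and c: "c > 0"
    and cont: "continuous_on {- 1 / p..1 / q} K"
    and der: "\<And>w. - 1 / p < w \<Longrightarrow> w < 1 / q \<Longrightarrow>
                (K has_real_derivative c * slope_weight p q w) (at w)"
  shows "p > q \<longrightarrow> K (1 / q) - K 0 < K 0 - K (- 1 / p)"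
    and "p = q \<longrightarrow> K (1 / q) - K 0 = K 0 - K (- 1 / p)"
    and "p < q \<longrightarrow> K (1 / q) - K 0 > K 0 - K (- 1 / p)"
proof -
  show "p > q \<longrightarrow> K (1 / q) - K 0 < K 0 - K (- 1 / p)"
    using slope_weight_halves_less[OF _ pq(2) c cont der] by blast
  have cont': "continuous_on {- 1 / q..1 / p} (\<lambda>w. - K (- w))"
    by (intro continuous_intros continuous_on_compose2[OF cont]) auto
  have der': "((\<lambda>w. - K (- w)) has_real_derivative c * slope_weight q p w) (at w)"
    if "- 1 / q < w" "w < 1 / p" for w
  proof -
    have "((\<lambda>w. K (- w)) has_real_derivative c * slope_weight p q (- w) * - 1) (at w)"
      by (rule DERIV_chain2[OF der]) (use that in \<open>auto intro!: derivative_eq_intros\<close>)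
    from DERIV_minus[OF this] show ?thesis by (simp add: slope_weight_swap)
  qed
  show "p < q \<longrightarrow> K (1 / q) - K 0 > K 0 - K (- 1 / p)"
    using slope_weight_halves_less[OF _ pq(1) c cont' der'] by auto
  show "p = q \<longrightarrow> K (1 / q) - K 0 = K 0 - K (- 1 / p)"
  proof
    assume "p = q"
    have "(\<lambda>w. K w - (- K (- w))) (1 / q) = (\<lambda>w. K w - (- K (- w))) 0"
    proof (rule DERIV_isconst2[where a = 0 and b = "1 / q"])
      show "continuous_on {0..1 / q} (\<lambda>w. K w - (- K (- w)))"
        by (rule continuous_on_diff; rule continuous_on_subset[OF cont] continuous_on_subset[OF cont'])
           (use pq \<open>p = q\<close> in auto)
      fix w assume w: "0 < w" "w < 1 / q"
      then have "- 1 / q < w" using pq by (smt (verit) divide_minus_left divide_pos_pos)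
      then show "((\<lambda>w. K w - (- K (- w))) has_real_derivative 0) (at w)"
        using DERIV_diff[OF der der', of w] w \<open>p = q\<close> by simp
    qed (use pq in auto)
    then show "K (1 / q) - K 0 = K 0 - K (- 1 / p)" using \<open>p = q\<close> by simp
  qed
qed

section \<open>The position of the peak\<close>

text \<open>Substituting \<open>t = T w\<close>, the inverse of \<open>w = (1 - (p + q) / p * t powr q) / q\<close>, in the arcsine integral
  produces \<open>slope_weight\<close>, and \<open>w = 1 / q, 0, - 1 / p\<close> correspond to \<open>t = 0, t0, 1\<close>. The minus sign in
  the primitive \<open>- F (T w)\<close> is there because \<open>T\<close> is decreasing.\<close>

lemma gen_arcsin_peak_compare:
  fixes p q :: real
  assumes "p > 1" "q > 1"
  defines "F \<equiv> gen_arcsin (conj_exp p) q" and "t0 \<equiv> (p / (p + q)) powr (1 / q)"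
  shows "p > q \<longrightarrow> 2 * F t0 < F 1" "p = q \<longrightarrow> 2 * F t0 = F 1" "p < q \<longrightarrow> 2 * F t0 > F 1"
proof -
  define s where "s = conj_exp p"
  have s: "s > 1" "- 1 / s = 1 / p - 1" using assms by (auto simp: s_def conj_exp_def field_simps)
  define T where "T w = (p / (p + q) * (1 - q * w)) powr (1 / q)" for w
  \<comment> \<open>Constant factors left over by \<open>1 - T w powr q = q / (p + q) * (1 + p * w)\<close> and by \<open>T'\<close>.\<close>
  define c where "c = (q / (p + q)) powr (1 / p - 1) * (p / (p + q)) powr (1 / q)"
  have c: "c > 0" using assms by (simp add: c_def)
  have base: "0 \<le> p / (p + q) * (1 - q * w) \<and> p / (p + q) * (1 - q * w) \<le> 1"
    if "- 1 / p \<le> w" "w \<le> 1 / q" for w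
  proof -
    have nn: "0 \<le> 1 - q * w" "0 \<le> 1 + p * w" using that assms by (auto simp: field_simps)
    have "1 - p / (p + q) * (1 - q * w) = q / (p + q) * (1 + p * w)"
      using assms(1,2) by (simp add: field_simps)
    moreover have "q / (p + q) * (1 + p * w) \<ge> 0" "p / (p + q) * (1 - q * w) \<ge> 0"
      using assms(1,2) nn by simp_all
    ultimately show ?thesis by (intro conjI) linarith+
  qed
  have T01: "T w \<in> {0..1}" if "w \<in> {- 1 / p..1 / q}" for w
  proof -
    have "\<bar>p / (p + q) * (1 - q * w)\<bar> \<le> 1"
      using base[of w] that by (simp only: atLeastAtMost_iff abs_of_nonneg)
    then have "T w \<le> 1" unfolding T_def using assms(2) by (intro powr_le1) simp_all
    then show ?thesis by (simp add: T_def)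
  qed
  have contT: "continuous_on {- 1 / p..1 / q} T" unfolding T_def
    by (intro continuous_intros continuous_on_powr') (use base assms in auto)
  have cont: "continuous_on {- 1 / p..1 / q} (\<lambda>w. - F (T w))"
    unfolding F_def s_def[symmetric]
    by (intro continuous_intros continuous_on_compose2[OF continuous_on_gen_arcsin contT])
       (use s assms T01 in auto)
  have der: "((\<lambda>w. - F (T w)) has_real_derivative c * slope_weight p q w) (at w)"
    if w: "- 1 / p < w" "w < 1 / q" for w
  proof -
    have pos: "0 < 1 - q * w" "0 < 1 + p * w" using that assms by (auto simp: field_simps)
    have e: "1 - p / (p + q) * (1 - q * w) = q / (p + q) * (1 + p * w)"
      using assms by (simp add: field_simps)
    have b: "0 < p / (p + q) * (1 - q * w)" using pos assms by simp
    have "0 < q / (p + q) * (1 + p * w)" using pos assms by simp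
    then have b1: "p / (p + q) * (1 - q * w) < 1" using e by linarith
    have T: "0 < T w" "T w < 1" using b b1 assms by (auto simp: T_def intro!: powr_less_1)
    have Tq: "1 - T w powr q = q / (p + q) * (1 + p * w)"
    proof -
      have "1 / q * q = 1" using assms(2) by simp
      then have "T w powr q = p / (p + q) * (1 - q * w)"
        using b by (simp only: T_def powr_powr powr_one less_imp_le)
      then show ?thesis using e by linarith
    qed
    have dT: "(T has_real_derivative - ((p / (p + q)) powr (1 / q) * (1 - q * w) powr (1 / q - 1))) (at w)"
    proof -
      define k where "k = p / (p + q)"
      have k: "k > 0" using assms(1,2) by (simp add: k_def)
      have lin: "((\<lambda>w. k * (1 - q * w)) has_real_derivative - (k * q)) (at w)"
        by (auto intro!: derivative_eq_intros)
      have T_eq: "T = (\<lambda>w. (k * (1 - q * w)) powr (1 / q))"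
        by (simp add: fun_eq_iff T_def k_def)
      have "(T has_real_derivative 1 / q * (k * (1 - q * w)) powr (1 / q - 1) * - (k * q)) (at w)"
        unfolding T_eq by (rule DERIV_powr_compose[OF lin]) (use k pos(1) in simp)
      moreover have "(k * (1 - q * w)) powr (1 / q - 1) * k = k powr (1 / q) * (1 - q * w) powr (1 / q - 1)"
        using k pos(1) by (simp add: powr_mult powr_diff)
      then have "1 / q * (k * (1 - q * w)) powr (1 / q - 1) * - (k * q)
          = - (k powr (1 / q) * (1 - q * w) powr (1 / q - 1))"
        using assms(2) by (simp add: mult_ac)
      ultimately show ?thesis by (simp add: k_def)
    qed
    have "((\<lambda>w. F (T w)) has_real_derivative (1 - T w powr q) powr (- 1 / s) *
            - ((p / (p + q)) powr (1 / q) * (1 - q * w) powr (1 / q - 1))) (at w)"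
      unfolding F_def s_def[symmetric]
      by (rule DERIV_chain2[OF DERIV_gen_arcsin dT]) (use s assms T in auto)
    from DERIV_minus[OF this] show ?thesis
      unfolding Tq s(2) powr_mult[of "q / (p + q)"] by (simp add: c_def slope_weight_def mult_ac)
  qed
  have T_ends: "T (1 / q) = 0" "T 0 = t0" using assms by (auto simp: T_def t0_def)
  have "1 - q * (- 1 / p) = (p + q) / p" using assms(1) by (simp add: field_simps)
  then have "p / (p + q) * (1 - q * (- 1 / p)) = 1" using assms(1,2) by simp
  then have T_end: "T (- 1 / p) = 1" by (simp only: T_def powr_one_eq_one)
  have "F 0 = 0" by (simp add: F_def gen_arcsin_0)
  then show "p > q \<longrightarrow> 2 * F t0 < F 1" "p = q \<longrightarrow> 2 * F t0 = F 1" "p < q \<longrightarrow> 2 * F t0 > F 1"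
    using slope_weight_halves_compare[OF assms(1,2) c cont der] unfolding T_ends T_end by auto
qed

section \<open>The extremum of the solution\<close>

theorem corollary2p5:
  fixes H p q :: real and u :: "real \<Rightarrow> real"
  assumes "H > 0" and "p > 1" and "q > 1"
    and "positive_solution H p q u"
    and "\<And>x. x \<in> {0..H} \<Longrightarrow>
      u x = 2 * H / (q * gen_pi (conj_exp p) q)
            * gen_cos (conj_exp p) q (gen_pi (conj_exp p) q / (2 * H) * x) powr (conj_exp p - 1)
            * gen_sin (conj_exp p) q (gen_pi (conj_exp p) q / (2 * H) * x)"
  shows "(\<exists>!x. x \<in> {0<..<H} \<and> local_extremum u x)
    \<and> x_ext H p q \<in> {0<..<H}
    \<and> local_extremum u (x_ext H p q)
    \<and> u (x_ext H p q) = 2 * H / (q * gen_pi (conj_exp p) q)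
          * (q / (p + q)) powr (1 / p) * (p / (p + q)) powr (1 / q)
    \<and> (\<forall>x\<in>{0..H}. u x \<le> u (x_ext H p q))
    \<and> (p > q \<longrightarrow> x_ext H p q < H / 2)
    \<and> (p = q \<longrightarrow> x_ext H p q = H / 2)
    \<and> (q > p \<longrightarrow> x_ext H p q > H / 2)"
proof -
  note pq = assms(2,3)
  define s where "s = conj_exp p"
  define P where "P = gen_pi s q"
  define S where "S x = gen_sin s q (P / (2 * H) * x)" for x
  define C where "C = 2 * H / (q * P)"
  define t0 where "t0 = (p / (p + q)) powr (1 / q)"
  define X where "X = x_ext H p q"
  have s: "s > 1" "1 / s * (s - 1) = 1 / p"
    using pq by (auto simp: s_def conj_exp_def field_simps)
  have P: "P > 0" unfolding P_def by (rule gen_pi_pos[OF s(1) pq(2)])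
  have C: "C > 0" using P assms by (simp add: C_def)
  have arg: "0 < P / (2 * H) * x" "P / (2 * H) * x < P / 2" if "x \<in> {0<..<H}" for x
    using that P assms(1) by (auto simp: field_simps)
  have S01: "0 < S x" "S x < 1" if "x \<in> {0<..<H}" for x
    using gen_sin_interior[OF s(1) pq(2), of "P / (2 * H) * x"] arg[OF that]
    by (auto simp: S_def P_def)
  have S_less: "S x < S y" if "x \<in> {0<..<H}" "y \<in> {0<..<H}" "x < y" for x y
    unfolding S_def
  proof (rule gen_sin_strict_mono[OF s(1) pq(2)])
    show "P / (2 * H) * x < P / (2 * H) * y"
      using that P assms(1) by (intro mult_strict_left_mono) auto
  qed (use arg[OF that(1)] arg[OF that(2)] in \<open>auto simp: P_def\<close>)
  have u_eq: "u x = C * shape p q (S x)" if x: "x \<in> {0<..<H}" for x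
  proof -
    have "gen_cos s q (P / (2 * H) * x) powr (s - 1)
        = ((1 - S x powr q) powr (1 / s)) powr (s - 1)"
      using gen_cos_eq[OF s(1) pq(2), of "P / (2 * H) * x"] arg[OF x] by (simp add: S_def P_def)
    also have "\<dots> = (1 - S x powr q) powr (1 / p)" by (simp only: powr_powr s(2))
    finally show ?thesis 
      using assms(5)[of x, folded s_def, folded P_def, folded S_def C_def] x
      by (simp add: shape_def)
  qed
  have t0: "0 < t0" "t0 < 1"
    using pq powr_less_1[of "p / (p + q)" "1 / q"] by (auto simp: t0_def)
  define a where "a = gen_arcsin s q t0"
  have a: "0 < a" "a < P / 2"
    using gen_arcsin_strict_mono[OF s(1) pq(2), of 0 t0]
      gen_arcsin_strict_mono[OF s(1) pq(2), of t0 1] t0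
    by (auto simp: a_def P_def gen_pi_def gen_arcsin_0)
  have X_eq: "X = 2 * H / P * a" by (simp add: X_def x_ext_def P_def s_def a_def t0_def)
  have X: "X \<in> {0<..<H}" using a P assms(1) by (auto simp: X_eq field_simps)
  have "P / (2 * H) * X = a" using P assms(1) by (simp add: X_eq)
  then have SX: "S X = t0"
    unfolding S_def using gen_sin_gen_arcsin[OF s(1) pq(2), of t0] t0 by (simp add: a_def)
  have inc: "u x < u y" if "0 < x" "x < y" "y \<le> X" for x y
  proof -
    have xy: "x \<in> {0<..<H}" "y \<in> {0<..<H}" using that X by auto
    have "S y \<le> t0" using S_less[of y X] xy(2) X that SX by (cases "y = X") auto
    then have "shape p q (S x) < shape p q (S y)"
      using S01(1)[OF xy(1)] S_less[OF xy that(2)] pq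
      by (intro shape_strict_mono) (auto simp: t0_def)
    then show ?thesis using C by (simp add: u_eq[OF xy(1)] u_eq[OF xy(2)])
  qed
  have dec: "u y < u x" if "X \<le> x" "x < y" "y < H" for x y
  proof -
    have xy: "x \<in> {0<..<H}" "y \<in> {0<..<H}" using that X by auto
    have "t0 \<le> S x" using S_less[of X x] xy(1) X that SX by (cases "x = X") auto
    then have "shape p q (S y) < shape p q (S x)"
      using S01(2)[OF xy(2)] S_less[OF xy that(2)] pq
      by (intro shape_strict_antimono) (auto simp: t0_def)
    then show ?thesis using C by (simp add: u_eq[OF xy(1)] u_eq[OF xy(2)])
  qed
  have max_int: "u x \<le> u X" if "x \<in> {0<..<H}" for x
    using inc[of x X] dec[of X x] that by (cases x X rule: linorder_cases) auto
  \<comment> \<open>At the end points, where \<open>gen_cos\<close> is a limit, the boundary condition gives \<open>u\<close> directly.\<close>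
  have bd: "u 0 = 0" "u H = 0" "u X > 0"
    using assms(4) X by (auto simp: positive_solution_def)
  have max: "u x \<le> u X" if "x \<in> {0..H}" for x
    using max_int[of x] bd that by (cases "x = 0"; cases "x = H") auto
  have "\<forall>\<^sub>F y in nhds X. y \<in> {0<..<H}" using X by (intro eventually_nhds_in_open) auto
  then have "\<forall>\<^sub>F y in nhds X. u y \<le> u X" by eventually_elim (rule max_int)
  then have ext: "local_extremum u X" by (simp add: local_extremum_def)
  have uniq: "x = X" if x: "x \<in> {0<..<H}" "local_extremum u x" for x
  proof (rule ccontr)
    assume "x \<noteq> X"
    then consider "x < X" | "X < x" by linarith
    then show False
    proof cases
      case 1
      have "strict_mono_on {0<..<X} u" by (rule strict_mono_onI) (use inc in auto)
      then show False using not_local_extremum_if_strict_mono[of 0 x X u] x 1 by auto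
    next
      case 2
      have "strict_mono_on {X<..<H} (\<lambda>x. - u x)" by (rule strict_mono_onI) (use dec in auto)
      then show False
        using not_local_extremum_if_strict_mono[of X x H "\<lambda>x. - u x"] x 2
        by (auto simp: local_extremum_uminus)
    qed
  qed
  have "t0 powr q = p / (p + q)" using pq by (simp add: t0_def powr_powr)
  then have "1 - t0 powr q = q / (p + q)" using pq by (simp add: field_simps)
  then have val: "u X = C * (q / (p + q)) powr (1 / p) * t0"
    by (simp add: u_eq[OF X] SX shape_def)
  have half: "X < H / 2 \<longleftrightarrow> 2 * a < P / 2" "X = H / 2 \<longleftrightarrow> 2 * a = P / 2"
    "X > H / 2 \<longleftrightarrow> 2 * a > P / 2"
    using P assms(1) by (auto simp: X_eq field_simps)
  have "P / 2 = gen_arcsin s q 1" by (simp add: P_def gen_pi_def)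
  with gen_arcsin_peak_compare[OF pq] half
  have cmp: "p > q \<longrightarrow> X < H / 2" "p = q \<longrightarrow> X = H / 2" "q > p \<longrightarrow> X > H / 2"
    by (simp_all add: a_def t0_def s_def)
  show ?thesis
    unfolding X_def[symmetric] s_def[symmetric] P_def[symmetric] C_def[symmetric] t0_def[symmetric]
    using X ext uniq val max cmp by blast
qed

end
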